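(* Let $n\in\mathbb{N}$. For every geodesic ray $\widetilde{\zeta}$ in $\mathbb{H}$ starting at the $y$-axis $I$ and with endpoint $\alpha>0$, there is a canonical projection $\zeta$ of $\widetilde{\zeta}$ onto $\Gamma_0(n)\backslash\mathbb{H}$ such that, for all $d\mid n$, the cutting sequence of $\widetilde{\zeta}$ with $\frac{1}{d}\mathcal{F}$ in $\mathbb{H}$ equals the cutting sequence of $\zeta$ with $T_{\{d,n\}}/{\sim}$ on $\Gamma_0(n)\backslash\mathbb{H}$: $$\left(\widetilde{\zeta},\tfrac{1}{d}\mathcal{F}\right)=\left(\zeta,\,T_{\{d,n\}}/{\sim}\right).$$
   Context: $\mathbb{H}$ is the upper half-plane with boundary $\mathbb{R}\cup\{\infty\}$; $I$ is the geodesic line from $0$ to $\infty$ and $I+1$ the geodesic line from $1$ to $\infty$. The Farey complex $\mathcal{F}$ is the ideal triangulation of $\mathbb{H}$ with vertex set $\mathbb{Q}\cup\{\infty\}$ ($\infty=\frac10$) in which reduced fractions $\frac pq,\frac rs$ are joined by a geodesic edge iff $|ps-qr|=1$. For $d\in\mathbb{N}$, $\frac1d\mathcal{F}$ is the image of $\mathcal{F}$ under $z\mapsto z/d$. $\Gamma_0(n)$ is the group of matrices $\begin{pmatrix}a&b\\c&e\end{pmatrix}\in SL_2(\mathbb{Z})$ with $c\equiv0\pmod n$, acting on $\mathbb{H}$ by Möbius transformations. Cutting sequences in $\mathbb{H}$. Let $T$ be an ideal triangulation of $\mathbb{H}$ and $\zeta$ an oriented geodesic ray starting at an edge of $T$ and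 ending in $\partial\mathbb{H}$. If $\zeta$ enters a triangle $ABC$ (vertices labelled clockwise) through $AB$, the triangle is a left triangle if $\zeta$ leaves through $BC$ and a right triangle if it leaves through $AC$ (if it leaves through $C$ it may be counted as either). The cutting sequence $(\zeta,T)$ is the word $L^{n_0}R^{n_1}L^{n_2}\cdots$ ($n_0\in\mathbb{N}\cup\{0\}$, $n_i\in\mathbb{N}$ for $i\ge1$) obtained by recording, in order, $L$ for each left triangle and $R$ for each right triangle. Special polygons. A Farey sequence is a sequence $\{\infty,x_0,\dots,x_r,\infty\}$ of points of $\mathbb{Q}\cup\{\infty\}$, containing $0$, whose consecutive members are neighbours in $\mathcal{F}$. Each consecutive pair is declared a free interval (free intervals come in pairs with the same label), an even interval, or an odd interval. The associated special polygon has boundary consisting of the geodesic between consecutive vertices for free and even intervals, and, for an odd interval $x_i,x_{i+1}$, the two geodesic segments from $x_i$ and from $x_{i+1}$ to the centre of the triangle of $\mathcal{F}$ with vertices $x_i$, $x_{i+1}$ and $x_i\oplus x_{i+1}$ (where $\frac ab\oplus\frac ce=\frac{a+c}{b+e}$). Paired free sides $(x_i,x_{i+1})$, $(x_j,x_{j+1})$ are identified by the map taking $x_i\mapsto x_{j+1}$, $x_{i+1}\mapsto x_j$; an even side is identified with itself by the elliptic involution exchanging $x_i$ and $x_{i+1}$; the two segments of an odd interval are identified by the order-3 rotation about the centre. $P_n$ denotes a special polygon that is a fundamental domain for $\Gamma_0(n)$ and has $I$ and $I+1$ as paired sides. For $d\mid n$, $T_{\{d,n\}}:=P_n\cup(P_n\cap\frac1d\mathcal{F})$,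 and $T_{\{d,n\}}/{\sim}$ is its quotient by the side identifications of $P_n$; it is the image of $\frac1d\mathcal{F}$ on $\Gamma_0(n)\backslash\mathbb{H}\cong P_n/{\sim}$. It may be completed by adding, for each cone point of angle $2\pi/3$, the unique "structural" arc joining that cone point to the cusp on the boundary of the monogon containing it; structural arcs are ignored when taking cutting sequences. Cutting sequences on the orbifold. A path $\zeta$ on $\Gamma_0(n)\backslash\mathbb{H}$ cuts a triangle of $T_{\{d,n\}}/{\sim}$ to form a left (right) triangle if, after removal of structural arcs, a lift of $\zeta$ to $\mathbb{H}$ cuts the corresponding lift of the triangle to form a left (right) triangle; $(\zeta,T_{\{d,n\}}/{\sim})$ is the resulting word in $L,R$. *)

theory Defs
  imports "HOL-Analysis.Analysis"
begin

section \<open>The upper half-plane, its boundary and its geodesics\<close>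

definition uhp :: "complex set" where
  "uhp = {z. Im z > 0}"

datatype bdry = Pt real | Infty

definition mob :: "real^2^2 \<Rightarrow> complex \<Rightarrow> complex" where
  "mob A z = (complex_of_real (A$1$1) * z + complex_of_real (A$1$2)) /
             (complex_of_real (A$2$1) * z + complex_of_real (A$2$2))"

fun bmob :: "real^2^2 \<Rightarrow> bdry \<Rightarrow> bdry" where
  "bmob A (Pt x) = (if A$2$1 * x + A$2$2 = 0 then Infty
                    else Pt ((A$1$1 * x + A$1$2) / (A$2$1 * x + A$2$2)))"
| "bmob A Infty = (if A$2$1 = 0 then Infty else Pt (A$1$1 / A$2$1))"

abbreviation realmat :: "int^2^2 \<Rightarrow> real^2^2" where
  "realmat \<equiv> map_matrix real_of_int"

text \<open>The imaginary axis is a geodesic, parametrised by hyperbolic arc length as \<open>\<i> e^t\<close>, and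
  \<open>SL(2,\<real>)\<close> acts transitively on unit tangent vectors by isometries, so the geodesics are exactly the
  images of this one. For \<open>geodesic_ray \<zeta>\<close> only the restriction of \<open>\<zeta>\<close> to \<open>t \<ge> 0\<close> is relevant.\<close>

definition geodesic :: "bdry \<Rightarrow> bdry \<Rightarrow> complex set" where
  "geodesic p q = {mob A (\<i> * complex_of_real (exp t)) | A t.
                     det A = 1 \<and> bmob A (Pt 0) = p \<and> bmob A Infty = q}"

definition geodesic_ray :: "(real \<Rightarrow> complex) \<Rightarrow> bool" where
  "geodesic_ray \<zeta> \<longleftrightarrow>
     (\<exists>A. det A = 1 \<and> (\<forall>t\<ge>0. \<zeta> t = mob A (\<i> * complex_of_real (exp t))))"

fun ends_at :: "(real \<Rightarrow> complex) \<Rightarrow> bdry \<Rightarrow> bool" where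
  "ends_at \<zeta> (Pt x) \<longleftrightarrow> (\<zeta> \<longlongrightarrow> complex_of_real x) at_top"
| "ends_at \<zeta> Infty \<longleftrightarrow> filterlim \<zeta> at_infinity at_top"

text \<open>The half-infinite geodesic segment between \<open>c\<close> in the upper half-plane and the ideal point \<open>x\<close>.\<close>

definition ideal_segment :: "complex \<Rightarrow> bdry \<Rightarrow> complex set" where
  "ideal_segment c x = \<Union>{\<zeta> ` {0..} | \<zeta>. geodesic_ray \<zeta> \<and> \<zeta> 0 = c \<and> ends_at \<zeta> x}"

text \<open>\<open>SL(2,\<real>)\<close> acts transitively on the ideal triples of a given orientation, and \<open>(0, \<infinity>, 1)\<close> is a
  clockwise one. \<open>ideal_triangle A B C\<close> is the open ideal triangle with clockwise vertices
  \<open>A, B, C\<close>; it is empty if the triple is not clockwise.\<close>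

definition clockwise :: "bdry \<Rightarrow> bdry \<Rightarrow> bdry \<Rightarrow> bool" where
  "clockwise A B C \<longleftrightarrow>
     (\<exists>M. det M = 1 \<and> bmob M (Pt 0) = A \<and> bmob M Infty = B \<and> bmob M (Pt 1) = C)"

definition ideal_triangle :: "bdry \<Rightarrow> bdry \<Rightarrow> bdry \<Rightarrow> complex set" where
  "ideal_triangle A B C =
     {mob M z | M z. det M = 1 \<and> bmob M (Pt 0) = A \<and> bmob M Infty = B \<and> bmob M (Pt 1) = C \<and>
                     z \<in> uhp \<and> 0 < Re z \<and> Re z < 1 \<and> cmod (z - 1/2) > 1/2}"

text \<open>The centre is the fixed point of the orientation-preserving isometry which rotates the vertices.\<close>

definition centre :: "bdry \<Rightarrow> bdry \<Rightarrow> bdry \<Rightarrow> complex" where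
  "centre A B C = (THE z. z \<in> uhp \<and>
     (\<exists>M. det M = 1 \<and> bmob M A = B \<and> bmob M B = C \<and> bmob M C = A \<and> mob M z = z))"


section \<open>The Farey complex\<close>

text \<open>A pair \<open>(p, q)\<close> stands for the fraction \<open>p/q\<close>; \<open>\<infinity>\<close> is \<open>1/0\<close> as well as \<open>-1/0\<close>.\<close>

fun frac_pt :: "int \<times> int \<Rightarrow> bdry" where
  "frac_pt (p, q) = (if q = 0 then Infty else Pt (real_of_int p / real_of_int q))"

fun farey_neighbours :: "int \<times> int \<Rightarrow> int \<times> int \<Rightarrow> bool" where
  "farey_neighbours (p, q) (r, s) \<longleftrightarrow> coprime p q \<and> coprime r s \<and> \<bar>p * s - q * r\<bar> = 1"

fun mediant :: "int \<times> int \<Rightarrow> int \<times> int \<Rightarrow> int \<times> int" where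
  "mediant (a, b) (c, e) = (a + c, b + e)"

text \<open>An ideal triangulation is represented by the union of its edges, a subset of the upper
  half-plane; its open triangles are then the components of the complement.\<close>

definition farey :: "complex set" where
  "farey = \<Union>{geodesic (frac_pt a) (frac_pt b) | a b. farey_neighbours a b}"

definition scaled_farey :: "nat \<Rightarrow> complex set" where
  "scaled_farey d = (\<lambda>z. z / of_nat d) ` farey"


section \<open>Cutting sequences in the upper half-plane\<close>

datatype letter = L | R

text \<open>A finite or infinite word is a function \<open>w :: nat \<Rightarrow> letter option\<close>, with \<open>None\<close> beyond its end.
  \<open>cutting_words crosses\<close> consists of the words read off along a ray with parameter \<open>t \<ge> 0\<close>, where
  \<open>crosses s u l\<close> means that during the time interval from \<open>s\<close> to \<open>u \<le> \<infinity>\<close> the ray cuts a triangle to form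
  a triangle of type \<open>l\<close>. The \<open>\<tau> k\<close> are the successive times at which the ray crosses an edge, with
  \<open>\<tau> k = \<infinity>\<close> after the last crossing of a ray which leaves its last triangle through a vertex. That
  \<open>\<tau>\<close> tends to \<open>\<infinity>\<close> says that every triangle met by the ray is recorded. As the last letter of a
  finite cutting sequence may be chosen freely, cutting sequences form a set of words.\<close>

definition cutting_words :: "(real \<Rightarrow> ereal \<Rightarrow> letter \<Rightarrow> bool) \<Rightarrow> (nat \<Rightarrow> letter option) set" where
  "cutting_words crosses = {w. \<exists>\<tau> :: nat \<Rightarrow> ereal. \<tau> 0 = 0 \<and> incseq \<tau> \<and> \<tau> \<longlonglongrightarrow> \<infinity> \<and>
     (\<forall>k. case w k of
            None \<Rightarrow> \<tau> k = \<infinity>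
          | Some l \<Rightarrow> \<tau> k \<noteq> \<infinity> \<and> crosses (real_of_ereal (\<tau> k)) (\<tau> (Suc k)) l)}"

text \<open>Between times \<open>s\<close> and \<open>u\<close> the ray \<open>\<zeta>\<close> crosses the triangle with clockwise vertices \<open>A, B, C\<close>: it
  enters through \<open>AB\<close> and leaves through \<open>BC\<close> (left), through \<open>AC\<close> (right), or through \<open>C\<close> (either).\<close>

definition cuts_triangle ::
  "(real \<Rightarrow> complex) \<Rightarrow> bdry \<Rightarrow> bdry \<Rightarrow> bdry \<Rightarrow> real \<Rightarrow> ereal \<Rightarrow> letter \<Rightarrow> bool" where
  "cuts_triangle \<zeta> A B C s u l \<longleftrightarrow>
     clockwise A B C \<and> ereal s < u \<and> \<zeta> s \<in> geodesic A B \<and>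
     (\<forall>t. s < t \<and> ereal t < u \<longrightarrow> \<zeta> t \<in> ideal_triangle A B C) \<and>
     (if u = \<infinity> then ends_at \<zeta> C
      else \<zeta> (real_of_ereal u) \<in> (case l of L \<Rightarrow> geodesic B C | R \<Rightarrow> geodesic A C))"

definition cutting_sequences :: "(real \<Rightarrow> complex) \<Rightarrow> complex set \<Rightarrow> (nat \<Rightarrow> letter option) set" where
  "cutting_sequences \<zeta> T = cutting_words (\<lambda>s u l.
     \<exists>A B C. ideal_triangle A B C \<in> components (uhp - T) \<and> cuts_triangle \<zeta> A B C s u l)"


section \<open>The orbifold of \<open>\<Gamma>\<^sub>0(n)\<close>\<close>

definition Gamma0 :: "nat \<Rightarrow> (int^2^2) set" where
  "Gamma0 n = {g. det g = 1 \<and> int n dvd g$2$1}"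

definition orbit :: "nat \<Rightarrow> complex \<Rightarrow> complex set" where
  "orbit n z = {mob (realmat g) z | g. g \<in> Gamma0 n}"

definition orbifold :: "nat \<Rightarrow> complex set set" where
  "orbifold n = orbit n ` uhp"

text \<open>The quotient topology.\<close>

definition orbifold_topology :: "nat \<Rightarrow> complex set topology" where
  "orbifold_topology n = topology (\<lambda>U. U \<subseteq> orbifold n \<and> open {z \<in> uhp. orbit n z \<in> U})"


section \<open>Special polygons\<close>

datatype label = Free nat | Even | Odd

text \<open>A Farey sequence \<open>\<infinity>, x\<^sub>0, \<dots>, x\<^sub>r, \<infinity>\<close> with \<open>cusps = [x\<^sub>0, \<dots>, x\<^sub>r]\<close> and one label for each of
  its \<open>r + 2\<close> intervals. The vertices of interval \<open>i\<close> are \<open>vertex S i\<close> and \<open>vertex S (Suc i)\<close>.\<close>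

record farey_symbol =
  cusps :: "rat list"
  labels :: "label list"

text \<open>The first vertex is \<open>-1/0\<close>, the last one \<open>1/0\<close>, so that the mediant of an interval ending at \<open>\<infinity>\<close>
  lies outside the polygon as for all other intervals.\<close>

definition fracs :: "farey_symbol \<Rightarrow> (int \<times> int) list" where
  "fracs S = (-1, 0) # map quotient_of (cusps S) @ [(1, 0)]"

definition vertex :: "farey_symbol \<Rightarrow> nat \<Rightarrow> bdry" where
  "vertex S i = frac_pt (fracs S ! i)"

definition odd_centre :: "farey_symbol \<Rightarrow> nat \<Rightarrow> complex" where
  "odd_centre S i =
     centre (vertex S i) (vertex S (Suc i)) (frac_pt (mediant (fracs S ! i) (fracs S ! Suc i)))"

definition boundary_part :: "farey_symbol \<Rightarrow> nat \<Rightarrow> complex set" where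
  "boundary_part S i =
     (if labels S ! i = Odd
      then ideal_segment (odd_centre S i) (vertex S i) \<union>
           ideal_segment (odd_centre S i) (vertex S (Suc i))
      else geodesic (vertex S i) (vertex S (Suc i)))"

definition valid_symbol :: "farey_symbol \<Rightarrow> bool" where
  "valid_symbol S \<longleftrightarrow>
     sorted_wrt (<) (cusps S) \<and> 0 \<in> set (cusps S) \<and>
     (\<forall>i \<le> length (cusps S). farey_neighbours (fracs S ! i) (fracs S ! Suc i)) \<and>
     length (labels S) = Suc (length (cusps S)) \<and>
     (\<forall>k. Free k \<in> set (labels S) \<longrightarrow> card {i. i < length (labels S) \<and> labels S ! i = Free k} = 2)"

definition special_polygon :: "farey_symbol \<Rightarrow> complex set \<Rightarrow> bool" where
  "special_polygon S P \<longleftrightarrow>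
     valid_symbol S \<and>
     interior P \<noteq> {} \<and> connected (interior P) \<and> P = uhp \<inter> closure (interior P) \<and>
     uhp \<inter> frontier P = (\<Union>i<length (labels S). boundary_part S i)"

text \<open>The pairs \<open>(s, g)\<close> of a boundary piece \<open>s\<close> and the element \<open>g\<close> of \<open>SL(2,\<int>)\<close> which identifies it with
  another one. The conditions determine \<open>g\<close> up to sign.\<close>

inductive_set side_pairings :: "farey_symbol \<Rightarrow> (complex set \<times> (int^2^2)) set"
  for S :: farey_symbol where
  free: "\<lbrakk>i < length (labels S); j < length (labels S); i \<noteq> j;
          labels S ! i = Free k; labels S ! j = Free k; det g = 1;
          bmob (realmat g) (vertex S i) = vertex S (Suc j);
          bmob (realmat g) (vertex S (Suc i)) = vertex S j\<rbrakk>
         \<Longrightarrow> (geodesic (vertex S i) (vertex S (Suc i)), g) \<in> side_pairings S"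
| even: "\<lbrakk>i < length (labels S); labels S ! i = Even; det g = 1;
          bmob (realmat g) (vertex S i) = vertex S (Suc i);
          bmob (realmat g) (vertex S (Suc i)) = vertex S i\<rbrakk>
         \<Longrightarrow> (geodesic (vertex S i) (vertex S (Suc i)), g) \<in> side_pairings S"
| odd: "\<lbrakk>i < length (labels S); labels S ! i = Odd; det g = 1;
          mob (realmat g) (odd_centre S i) = odd_centre S i;
          bmob (realmat g) (vertex S i) = vertex S (Suc i)\<rbrakk>
         \<Longrightarrow> (ideal_segment (odd_centre S i) (vertex S i), g) \<in> side_pairings S"

definition side_equiv :: "farey_symbol \<Rightarrow> complex set \<Rightarrow> (complex \<times> complex) set" where
  "side_equiv S P =
     (let r = {(z, mob (realmat g) z) | s g z. (s, g) \<in> side_pairings S \<and> z \<in> s}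
      in (r \<union> r\<inverse>)\<^sup>* \<inter> P \<times> P)"

definition fundamental_domain :: "nat \<Rightarrow> farey_symbol \<Rightarrow> complex set \<Rightarrow> bool" where
  "fundamental_domain n S P \<longleftrightarrow>
     (\<forall>z\<in>uhp. \<exists>g\<in>Gamma0 n. mob (realmat g) z \<in> P) \<and>
     (\<forall>g\<in>Gamma0 n. mob (realmat g) ` interior P \<inter> interior P \<noteq> {} \<longrightarrow>
        (\<forall>z\<in>uhp. mob (realmat g) z = z)) \<and>
     (\<forall>(s, g)\<in>side_pairings S. g \<in> Gamma0 n)"

definition paired_sides :: "farey_symbol \<Rightarrow> bdry \<times> bdry \<Rightarrow> bdry \<times> bdry \<Rightarrow> bool" where
  "paired_sides S e f \<longleftrightarrow>
     (\<exists>i j k. i < length (labels S) \<and> j < length (labels S) \<and> i \<noteq> j \<and>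
        labels S ! i = Free k \<and> labels S ! j = Free k \<and>
        e = (vertex S i, vertex S (Suc i)) \<and> f = (vertex S j, vertex S (Suc j)))"

text \<open>The polygons \<open>P\<^sub>n\<close>. For \<open>n = 1\<close> no fundamental special polygon has \<open>I\<close> and \<open>I + 1\<close> as sides: an
  ideal triangle has area \<open>\<pi>\<close>, but the modular orbifold has area \<open>\<pi>/3\<close>. In this case any
  special polygon which is a fundamental domain is admitted.\<close>

definition is_Pn :: "nat \<Rightarrow> farey_symbol \<Rightarrow> complex set \<Rightarrow> bool" where
  "is_Pn n S P \<longleftrightarrow> special_polygon S P \<and> fundamental_domain n S P \<and>
     (n \<noteq> 1 \<longrightarrow> paired_sides S (Infty, Pt 0) (Pt 1, Infty))"

text \<open>The arcs of the triangulation of \<open>P\<^sub>n/\<sim>\<close>, as a set of points of \<open>P\<^sub>n/\<sim>\<close>. The sides of \<open>P\<^sub>n\<close> belong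
  to it only where they lie on \<open>(1/d)\<F>\<close>, since this is to be the image of \<open>(1/d)\<F>\<close>; structural arcs
  are left out, since they are to be ignored by cutting sequences.\<close>

definition quotient_triangulation ::
  "nat \<Rightarrow> farey_symbol \<Rightarrow> complex set \<Rightarrow> complex set set" where
  "quotient_triangulation d S P = (P \<inter> scaled_farey d) // side_equiv S P"

text \<open>The identification of \<open>P\<^sub>n/\<sim>\<close> with the orbifold. All points of a class \<open>c\<close> have the same orbit.\<close>

definition to_orbifold :: "nat \<Rightarrow> complex set \<Rightarrow> complex set" where
  "to_orbifold n c = (\<Union>z\<in>c. orbit n z)"


section \<open>Cutting sequences on the orbifold\<close>

text \<open>Here \<open>Y\<close> is the set of points on the arcs of the triangulation, and its triangles are the
  components \<open>\<Delta>\<close> of the complement, which may contain a cone point. Lifts of \<open>\<zeta>\<close> are required to be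
  geodesic: an arbitrary continuous lift of a path through a cone point may turn there.\<close>

definition lift_of :: "nat \<Rightarrow> (real \<Rightarrow> complex set) \<Rightarrow> (real \<Rightarrow> complex) \<Rightarrow> bool" where
  "lift_of n \<zeta> \<eta> \<longleftrightarrow> geodesic_ray \<eta> \<and> (\<forall>t\<ge>0. orbit n (\<eta> t) = \<zeta> t)"

definition orbifold_cutting_sequences ::
  "nat \<Rightarrow> (real \<Rightarrow> complex set) \<Rightarrow> complex set set \<Rightarrow> (nat \<Rightarrow> letter option) set" where
  "orbifold_cutting_sequences n \<zeta> Y = cutting_words (\<lambda>s u l.
     \<exists>\<Delta> \<in> connected_components_of (subtopology (orbifold_topology n) (orbifold n - Y)).
     \<exists>\<eta> A B C. lift_of n \<zeta> \<eta> \<and>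
       ideal_triangle A B C \<in> components {z \<in> uhp. orbit n z \<in> \<Delta>} \<and>
       cuts_triangle \<eta> A B C s u l)"

end

theory Submission
  imports Defs
begin

text \<open>The complex \<open>(1/d)\<F>\<close> is invariant under \<open>\<Gamma>\<^sub>0(n)\<close>, so that the triangles on the
  orbifold pull back to those of \<open>(1/d)\<F>\<close>, cone points or not: a component of the complement in the
  upper half-plane is a component of the preimage of the component containing its image. It remains to
  see that every geodesic lift of \<open>\<zeta>\<close> has the same cutting sequences. By countability of \<open>\<Gamma>\<^sub>0(n)\<close>,
  one group element matches two given lifts at infinitely many times. Two geodesic rays which agree
  that often coincide, as their equality at time \<open>t\<close> is a polynomial equation in \<open>e^t\<close>; so the lifts
  differ by that element, which maps triangles to triangles of the same type.\<close>

section \<open>Moebius transformations\<close>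

lemma det_matrix_mult_2:
  fixes A B :: "'a::comm_ring_1^2^2"
  shows "det (A ** B) = det A * det B"
  by (simp add: det_2 matrix_matrix_mult_def sum_2 algebra_simps)

lemma denominator_nonzero:
  fixes A :: "real^2^2"
  assumes "det A = 1" "z \<in> uhp"
  shows "complex_of_real (A$2$1) * z + complex_of_real (A$2$2) \<noteq> 0"
proof
  assume eq: "complex_of_real (A$2$1) * z + complex_of_real (A$2$2) = 0"
  have "A$2$1 * Im z = 0" "A$2$1 * Re z + A$2$2 = 0"
    using arg_cong[OF eq, of Im] arg_cong[OF eq, of Re] by simp_all
  with assms show False
    by (auto simp: uhp_def det_2)
qed

lemma mob_in_uhp:
  assumes "det A = 1" "z \<in> uhp"
  shows "mob A z \<in> uhp"
proof -
  let ?w = "complex_of_real (A$2$1) * z + complex_of_real (A$2$2)"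
  have nz: "?w \<noteq> 0"
    using assms by (rule denominator_nonzero)
  have "Im (mob A z) = (det A * Im z) / (cmod ?w)\<^sup>2"
    unfolding mob_def Im_divide by (simp add: cmod_power2 det_2 algebra_simps)
  with assms nz show ?thesis
    by (simp add: uhp_def)
qed

text \<open>The inner denominator \<open>D\<close> is nonzero by \<open>det B = 1\<close> and
  cancels. Where the outer denominator vanishes, both sides are 0 because
  \<open>x / 0 = 0\<close>.\<close>

lemma mob_mult:
  assumes "det B = 1" "z \<in> uhp"
  shows "mob (A ** B) z = mob A (mob B z)"
proof -
  define N D where "N = complex_of_real (B$1$1) * z + complex_of_real (B$1$2)"
    and "D = complex_of_real (B$2$1) * z + complex_of_real (B$2$2)"
  have D: "D \<noteq> 0"
    unfolding D_def using assms by (rule denominator_nonzero)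
  have lin: "complex_of_real a * (N / D) + complex_of_real b
      = (complex_of_real a * N + complex_of_real b * D) / D" for a b
    using D by (simp add: field_simps)
  have "mob A (mob B z) = (complex_of_real (A$1$1) * N + complex_of_real (A$1$2) * D) /
      (complex_of_real (A$2$1) * N + complex_of_real (A$2$2) * D)"
    unfolding mob_def N_def[symmetric] D_def[symmetric] lin using D by simp
  also have "\<dots> = mob (A ** B) z"
    unfolding mob_def N_def D_def
    by (simp add: matrix_matrix_mult_def sum_2 algebra_simps)
  finally show ?thesis ..
qed

lemma bmob_mult:
  assumes "det A = 1" "det B = 1"
  shows "bmob (A ** B) p = bmob A (bmob B p)"
proof (cases p)
  case Infty
  have "B$1$1 \<noteq> 0" if "B$2$1 = 0"
    using assms that by (auto simp: det_2)
  moreover have "A$1$1 \<noteq> 0 \<or> A$2$1 \<noteq> 0"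
    using assms by (auto simp: det_2)
  moreover have "a * (B$1$1 / B$2$1) + b = (a * B$1$1 + b * B$2$1) / B$2$1" if "B$2$1 \<noteq> 0" for a b
    using that by (simp add: field_simps)
  ultimately show ?thesis
    using Infty by (auto simp: matrix_matrix_mult_def sum_2)
next
  case (Pt x)
  define N D where "N = B$1$1 * x + B$1$2" and "D = B$2$1 * x + B$2$2"
  \<comment> \<open>\<open>det B\<close> is a linear combination of \<open>N\<close> and
    \<open>D\<close>, so they never vanish together. Thus \<open>D = 0\<close> is a genuine pole,
    and there the factor \<open>N\<close> cancels from the composite.\<close>
  have ND: "N \<noteq> 0" if "D = 0"
  proof
    assume "N = 0"
    have "det B = B$1$1 * D - B$2$1 * N"
      by (simp add: det_2 N_def D_def algebra_simps)
    with that \<open>N = 0\<close> assms show False by simp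
  qed
  have B: "bmob B p = (if D = 0 then Infty else Pt (N / D))"
    by (simp add: Pt N_def D_def)
  have AB: "bmob (A ** B) p = (if A$2$1 * N + A$2$2 * D = 0 then Infty
      else Pt ((A$1$1 * N + A$1$2 * D) / (A$2$1 * N + A$2$2 * D)))"
    by (simp add: Pt N_def D_def matrix_matrix_mult_def sum_2 algebra_simps)
  have lin: "a * N / D + b = (a * N + b * D) / D" if "D \<noteq> 0" for a b
    using that by (simp add: field_simps)
  show ?thesis
    unfolding AB B using ND by (simp add: lin)
qed

text \<open>The adjugate, which is the inverse at determinant 1. It makes sense over any commutative
  ring, so inverses in \<open>Gamma0 n\<close> stay integral and \<open>realmat\<close> commutes
  with inversion.\<close>

definition adj2 :: "'a::comm_ring_1^2^2 \<Rightarrow> 'a^2^2" where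
  "adj2 A = vector [vector [A$2$2, - A$1$2], vector [- A$2$1, A$1$1]]"

lemma adj2_nth [simp]:
  "adj2 A $ 1 $ 1 = A$2$2" "adj2 A $ 1 $ 2 = - A$1$2"
  "adj2 A $ 2 $ 1 = - A$2$1" "adj2 A $ 2 $ 2 = A$1$1"
  by (simp_all add: adj2_def)

lemma det_adj2 [simp]: "det (adj2 A) = det A"
  by (simp add: det_2 algebra_simps)

lemma adj2_mult: "det A = 1 \<Longrightarrow> adj2 A ** A = mat 1"
  by (simp add: vec_eq_iff forall_2 matrix_matrix_mult_def sum_2 mat_def det_2 algebra_simps)

lemma mult_adj2: "det A = 1 \<Longrightarrow> A ** adj2 A = mat 1"
  by (simp add: vec_eq_iff forall_2 matrix_matrix_mult_def sum_2 mat_def det_2 algebra_simps)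

lemma mob_one [simp]: "mob (mat 1) z = z"
  by (simp add: mob_def mat_def)

lemma bmob_one: "bmob (mat 1) p = p"
  by (cases p) (simp_all add: mat_def)

declare bmob.simps [simp del]

lemma mob_adj2: "det A = 1 \<Longrightarrow> z \<in> uhp \<Longrightarrow> mob (adj2 A) (mob A z) = z"
  by (metis mob_mult adj2_mult mob_one)

lemma mob_adj2': "det A = 1 \<Longrightarrow> z \<in> uhp \<Longrightarrow> mob A (mob (adj2 A) z) = z"
  by (metis mob_mult mult_adj2 mob_one det_adj2)

lemma bmob_adj2: "det A = 1 \<Longrightarrow> bmob (adj2 A) (bmob A p) = p"
  by (metis bmob_mult adj2_mult bmob_one det_adj2)

lemma continuous_on_mob:
  assumes "det A = 1"
  shows "continuous_on uhp (mob A)"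
  unfolding mob_def using denominator_nonzero[OF assms]
  by (intro continuous_intros) auto

section \<open>Action on geodesics and ideal triangles\<close>

lemma imaginary_axis_in_uhp: "\<i> * complex_of_real (exp t) \<in> uhp"
  by (simp add: uhp_def)

lemma geodesic_subset_uhp: "geodesic p q \<subseteq> uhp"
  by (auto simp: geodesic_def intro: mob_in_uhp imaginary_axis_in_uhp)

text \<open>A point of a geodesic comes with a matrix carrying the imaginary axis there, so
  \<open>M\<close> acts by left multiplication on that matrix. Clockwise triples and ideal triangles
  are transported in the same way.\<close>

lemma mob_in_geodesic:
  assumes M: "det M = 1" and z: "z \<in> geodesic p q"
  shows "mob M z \<in> geodesic (bmob M p) (bmob M q)"
proof -
  obtain A t where A: "z = mob A (\<i> * complex_of_real (exp t))" "det A = 1"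
      "bmob A (Pt 0) = p" "bmob A Infty = q"
    using z unfolding geodesic_def by blast
  then have "mob M z = mob (M ** A) (\<i> * complex_of_real (exp t))"
    "det (M ** A) = 1" "bmob (M ** A) (Pt 0) = bmob M p" "bmob (M ** A) Infty = bmob M q"
    using M by (simp_all add: mob_mult imaginary_axis_in_uhp det_matrix_mult_2 bmob_mult)
  then show ?thesis
    unfolding geodesic_def by blast
qed

lemma clockwise_bmob:
  assumes "det M = 1" "clockwise A B C"
  shows "clockwise (bmob M A) (bmob M B) (bmob M C)"
proof -
  obtain N where "det N = 1" "bmob N (Pt 0) = A" "bmob N Infty = B" "bmob N (Pt 1) = C"
    using assms(2) unfolding clockwise_def by blast
  then show ?thesis
    unfolding clockwise_def using assms(1)
    by (intro exI[of _ "M ** N"]) (simp add: det_matrix_mult_2 bmob_mult)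
qed

lemma ideal_triangle_subset_uhp: "ideal_triangle A B C \<subseteq> uhp"
  by (auto simp: ideal_triangle_def intro: mob_in_uhp)

lemma mob_in_ideal_triangle:
  assumes M: "det M = 1" and z: "z \<in> ideal_triangle A B C"
  shows "mob M z \<in> ideal_triangle (bmob M A) (bmob M B) (bmob M C)"
proof -
  obtain N w where N: "z = mob N w" "det N = 1" "bmob N (Pt 0) = A" "bmob N Infty = B"
      "bmob N (Pt 1) = C" and w: "w \<in> uhp" "0 < Re w" "Re w < 1" "cmod (w - 1/2) > 1/2"
    using z unfolding ideal_triangle_def by blast
  have "mob M z = mob (M ** N) w" "det (M ** N) = 1" "bmob (M ** N) (Pt 0) = bmob M A"
    "bmob (M ** N) Infty = bmob M B" "bmob (M ** N) (Pt 1) = bmob M C"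
    using M N w by (simp_all add: mob_mult det_matrix_mult_2 bmob_mult)
  with w show ?thesis
    unfolding ideal_triangle_def by blast
qed

lemma mob_image_ideal_triangle:
  assumes M: "det M = 1"
  shows "mob M ` ideal_triangle A B C = ideal_triangle (bmob M A) (bmob M B) (bmob M C)"
proof
  show "mob M ` ideal_triangle A B C \<subseteq> ideal_triangle (bmob M A) (bmob M B) (bmob M C)"
    using mob_in_ideal_triangle[OF M] by blast
  show "ideal_triangle (bmob M A) (bmob M B) (bmob M C) \<subseteq> mob M ` ideal_triangle A B C"
  proof
    fix z assume z: "z \<in> ideal_triangle (bmob M A) (bmob M B) (bmob M C)"
    then have "mob (adj2 M) z \<in> ideal_triangle A B C"
      using mob_in_ideal_triangle[OF _ z, of "adj2 M"] M by (simp add: bmob_adj2)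
    moreover have "z = mob M (mob (adj2 M) z)"
      using M z ideal_triangle_subset_uhp by (simp add: mob_adj2' subset_iff)
    ultimately show "z \<in> mob M ` ideal_triangle A B C"
      by blast
  qed
qed

section \<open>Geodesic rays\<close>

lemma geodesic_ray_in_uhp: "geodesic_ray \<zeta> \<Longrightarrow> 0 \<le> t \<Longrightarrow> \<zeta> t \<in> uhp"
  by (auto simp: geodesic_ray_def intro!: mob_in_uhp imaginary_axis_in_uhp)

lemma ideal_segment_subset_uhp: "ideal_segment c x \<subseteq> uhp"
  by (auto simp: ideal_segment_def intro!: geodesic_ray_in_uhp)

text \<open>A ray is specified only for \<open>t \<ge> 0\<close>, and limits along
  \<open>at_top\<close> do not see other times.\<close>

lemma ends_at_cong:
  assumes "\<And>t. 0 \<le> t \<Longrightarrow> \<zeta> t = \<eta> t"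
  shows "ends_at \<zeta> p \<longleftrightarrow> ends_at \<eta> p"
proof -
  have "eventually (\<lambda>t. \<zeta> t = \<eta> t) at_top"
    using eventually_ge_at_top[of 0] by eventually_elim (rule assms)
  then show ?thesis
    using tendsto_cong[of \<zeta> \<eta> at_top] filterlim_cong[OF refl refl, of \<zeta> \<eta> at_top at_infinity]
    by (cases p) auto
qed

lemma ends_at_unique:
  assumes "ends_at \<zeta> p" "ends_at \<zeta> q"
  shows "p = q"
  using assms not_tendsto_and_filterlim_at_infinity[of "at_top :: real filter" \<zeta>]
    tendsto_unique[of "at_top :: real filter" \<zeta>]
  by (cases p; cases q) fastforce+

lemma ends_at_geodesic:
  assumes "det A = 1"
  shows "ends_at (\<lambda>t. mob A (\<i> * complex_of_real (exp t))) (bmob A Infty)"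
proof -
  let ?z = "\<lambda>t. \<i> * complex_of_real (exp t)"
  have "filterlim (\<lambda>t. norm (?z t)) at_top at_top"
    by (simp add: norm_mult exp_at_top)
  then have inf: "filterlim ?z at_infinity at_top"
    by (simp add: filterlim_norm_at_top_imp_at_infinity)
  show ?thesis
  proof (cases "A$2$1 = 0")
    case True
    then have "A$1$1 \<noteq> 0" "A$2$2 \<noteq> 0"
      using assms by (auto simp: det_2)
    then have "filterlim (\<lambda>t. complex_of_real (A$1$2) / complex_of_real (A$2$2) +
        (complex_of_real (A$1$1) / complex_of_real (A$2$2)) * ?z t) at_infinity at_top"
      by (intro tendsto_add_filterlim_at_infinity[OF tendsto_const]
          tendsto_mult_filterlim_at_infinity[OF tendsto_const _ inf]) simp
    with True show ?thesis
      by (simp add: mob_def bmob.simps add_divide_distrib add.commute)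
  next
    case False
    have nz: "?z t \<noteq> 0" for t
      by simp
    \<comment> \<open>Numerator and denominator are divided by \<open>?z t\<close>, which tends to
      infinity, so the limit is \<open>A$1$1 / A$2$1\<close>.\<close>
    have "((\<lambda>t. (complex_of_real (A$1$1) + complex_of_real (A$1$2) / ?z t) /
        (complex_of_real (A$2$1) + complex_of_real (A$2$2) / ?z t)) \<longlongrightarrow>
        (complex_of_real (A$1$1) + 0) / (complex_of_real (A$2$1) + 0)) at_top"
      using False
      by (intro tendsto_intros tendsto_divide_0[OF tendsto_const inf]) simp
    moreover have "(complex_of_real a + complex_of_real b / z) / (complex_of_real c + complex_of_real d / z)
        = (complex_of_real a * z + complex_of_real b) / (complex_of_real c * z + complex_of_real d)"
      if "z \<noteq> 0" for a b c d z
    proof -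
      have "complex_of_real r + complex_of_real s / z
          = (complex_of_real r * z + complex_of_real s) / z" for r s
        using that by (simp add: field_simps)
      then show ?thesis
        using that by simp
    qed
    ultimately show ?thesis
      using False by (simp add: mob_def bmob.simps nz del: mult_eq_0_iff)
  qed
qed

text \<open>This avoids continuity of \<open>M\<close> at the boundary and its poles: a ray with
  matrix \<open>A\<close> ends at \<open>bmob A Infty\<close>, uniqueness of ends identifies this
  point with \<open>p\<close>, and the image ray has matrix \<open>M ** A\<close>.\<close>

lemma ends_at_mob:
  assumes M: "det M = 1" and \<zeta>: "geodesic_ray \<zeta>" "ends_at \<zeta> p"
    and \<eta>: "\<And>t. 0 \<le> t \<Longrightarrow> \<eta> t = mob M (\<zeta> t)"
  shows "ends_at \<eta> (bmob M p)"
proof -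
  obtain A where A: "det A = 1" "\<And>t. 0 \<le> t \<Longrightarrow> \<zeta> t = mob A (\<i> * complex_of_real (exp t))"
    using \<zeta>(1) unfolding geodesic_ray_def by blast
  have "ends_at \<zeta> (bmob A Infty) \<longleftrightarrow> ends_at (\<lambda>t. mob A (\<i> * complex_of_real (exp t))) (bmob A Infty)"
    by (rule ends_at_cong) (rule A(2))
  then have "ends_at \<zeta> (bmob A Infty)"
    using ends_at_geodesic[OF A(1)] by (simp only:)
  then have p: "p = bmob A Infty"
    by (rule ends_at_unique[OF \<zeta>(2)])
  have MA: "\<eta> t = mob (M ** A) (\<i> * complex_of_real (exp t))" if "0 \<le> t" for t
    using that A M \<eta> by (simp add: mob_mult imaginary_axis_in_uhp)
  have "det (M ** A) = 1"
    using A M by (simp add: det_matrix_mult_2)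
  then have "ends_at (\<lambda>t. mob (M ** A) (\<i> * complex_of_real (exp t))) (bmob (M ** A) Infty)"
    by (rule ends_at_geodesic)
  moreover have "ends_at \<eta> (bmob (M ** A) Infty) \<longleftrightarrow>
      ends_at (\<lambda>t. mob (M ** A) (\<i> * complex_of_real (exp t))) (bmob (M ** A) Infty)"
    by (rule ends_at_cong) (rule MA)
  ultimately have "ends_at \<eta> (bmob (M ** A) Infty)"
    by (simp only:)
  then show ?thesis
    using A M p by (simp add: bmob_mult)
qed

lemma geodesic_eq_if_infinitely_often:
  assumes AB: "det A = 1" "det B = 1"
    and inf: "infinite {t. mob A (\<i> * complex_of_real (exp t)) = mob B (\<i> * complex_of_real (exp t))}"
  shows "mob A (\<i> * complex_of_real (exp t)) = mob B (\<i> * complex_of_real (exp t))"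
proof -
  let ?z = "\<lambda>t. \<i> * complex_of_real (exp t)"
  \<comment> \<open>\<open>lin r s\<close> is the polynomial r X + s, so \<open>q\<close> is the
    difference of the two fractions after cross-multiplication. As no denominator vanishes on
    \<open>uhp\<close>, the rays agree at time \<open>t\<close> exactly when \<open>?z t\<close> is
    a root of \<open>q\<close>.\<close>
  define lin where "lin = (\<lambda>r s. [:complex_of_real s, complex_of_real r:])"
  define q where "q = lin (A$1$1) (A$1$2) * lin (B$2$1) (B$2$2) - lin (B$1$1) (B$1$2) * lin (A$2$1) (A$2$2)"
  have q: "mob A (?z t) = mob B (?z t) \<longleftrightarrow> poly q (?z t) = 0" for t
    using denominator_nonzero[OF AB(1) imaginary_axis_in_uhp[of t]]
      denominator_nonzero[OF AB(2) imaginary_axis_in_uhp[of t]]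
    by (simp add: mob_def q_def lin_def frac_eq_eq mult.commute[of "poly _ _"]) (simp add: algebra_simps)
  have "inj ?z"
    by (auto simp: inj_on_def)
  then have "infinite (?z ` {t. mob A (?z t) = mob B (?z t)})"
    using inf by (simp add: finite_image_iff inj_on_subset)
  moreover have "?z ` {t. mob A (?z t) = mob B (?z t)} \<subseteq> {z. poly q z = 0}"
    using q by auto
  ultimately have "infinite {z. poly q z = 0}"
    using finite_subset by blast
  then have "q = 0"
    using poly_roots_finite by blast
  then show ?thesis
    using q by simp
qed

section \<open>The group and its orbits\<close>

lemma realmat_mult: "realmat (g ** h) = realmat g ** realmat h"
  by (simp add: vec_eq_iff forall_2 matrix_matrix_mult_def sum_2 map_matrix_def)

lemma det_realmat: "det (realmat g) = real_of_int (det g)"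
  by (simp add: det_2 map_matrix_def)

lemma realmat_adj2: "realmat (adj2 g) = adj2 (realmat g)"
  by (simp add: vec_eq_iff forall_2 map_matrix_def)

lemma realmat_one: "realmat (mat 1) = mat 1"
  by (simp add: vec_eq_iff forall_2 map_matrix_def mat_def)

lemma Gamma0_det: "g \<in> Gamma0 n \<Longrightarrow> det (realmat g) = 1"
  by (simp add: Gamma0_def det_realmat)

lemma Gamma0_one: "mat 1 \<in> Gamma0 n"
  by (simp add: Gamma0_def det_2 mat_def)

lemma Gamma0_mult: "g \<in> Gamma0 n \<Longrightarrow> h \<in> Gamma0 n \<Longrightarrow> g ** h \<in> Gamma0 n"
  unfolding Gamma0_def by (simp add: det_matrix_mult_2) (simp add: matrix_matrix_mult_def sum_2)

lemma Gamma0_adj2: "g \<in> Gamma0 n \<Longrightarrow> adj2 g \<in> Gamma0 n"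
  by (simp add: Gamma0_def)

lemma countable_Gamma0: "countable (Gamma0 n)"
proof -
  let ?f = "\<lambda>g :: int^2^2. (g$1$1, g$1$2, g$2$1, g$2$2)"
  have "inj ?f"
    by (auto simp: inj_on_def vec_eq_iff forall_2)
  then show ?thesis
    by (meson countableI_type countable_image_inj_on inj_on_subset subset_UNIV
        countable_image_inj_eq)
qed

lemma in_orbit_self: "z \<in> orbit n z"
  unfolding orbit_def using Gamma0_one[of n] realmat_one mob_one by (metis (mono_tags, lifting) mem_Collect_eq)

lemma orbit_mob:
  assumes g: "g \<in> Gamma0 n" and z: "z \<in> uhp"
  shows "orbit n (mob (realmat g) z) = orbit n z"
proof
  have "mob (realmat h) (mob (realmat g) z) = mob (realmat (h ** g)) z" for h
    using g z by (simp add: realmat_mult mob_mult Gamma0_det)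
  then show "orbit n (mob (realmat g) z) \<subseteq> orbit n z"
    unfolding orbit_def using Gamma0_mult[OF _ g] by blast
  have "mob (realmat h) z = mob (realmat (h ** adj2 g)) (mob (realmat g) z)" for h
    using g z by (simp add: realmat_mult realmat_adj2 mob_mult Gamma0_det mob_adj2 mob_in_uhp)
  then show "orbit n z \<subseteq> orbit n (mob (realmat g) z)"
    unfolding orbit_def using Gamma0_mult[OF _ Gamma0_adj2[OF g]] by blast
qed

lemma orbit_eqD:
  assumes "orbit n z = orbit n w"
  obtains g where "g \<in> Gamma0 n" "w = mob (realmat g) z"
  using in_orbit_self[of w n] assms unfolding orbit_def by auto

lemma lifts_differ_by_Gamma0:
  assumes \<zeta>: "geodesic_ray \<zeta>" and \<eta>: "geodesic_ray \<eta>"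
    and orb: "\<And>t. 0 \<le> t \<Longrightarrow> orbit n (\<eta> t) = orbit n (\<zeta> t)"
  obtains g where "g \<in> Gamma0 n" "\<And>t. 0 \<le> t \<Longrightarrow> \<zeta> t = mob (realmat g) (\<eta> t)"
proof -
  obtain A where A: "det A = 1" "\<And>t. 0 \<le> t \<Longrightarrow> \<zeta> t = mob A (\<i> * complex_of_real (exp t))"
    using \<zeta> unfolding geodesic_ray_def by blast
  obtain B where B: "det B = 1" "\<And>t. 0 \<le> t \<Longrightarrow> \<eta> t = mob B (\<i> * complex_of_real (exp t))"
    using \<eta> unfolding geodesic_ray_def by blast
  \<comment> \<open>A priori the group element relating the two lifts depends on the time. The sets
    \<open>E g\<close> cover an uncountable interval, so one of the countably many is uncountable,
    in particular infinite.\<close>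
  define E where "E g = {t. 0 \<le> t \<and> \<zeta> t = mob (realmat g) (\<eta> t)}" for g
  have "{0..1} \<subseteq> (\<Union>g\<in>Gamma0 n. E g)"
  proof
    fix t :: real assume "t \<in> {0..1}"
    then have t: "0 \<le> t" by simp
    obtain g where "g \<in> Gamma0 n" "\<zeta> t = mob (realmat g) (\<eta> t)"
      using orbit_eqD[OF orb[OF t]] by blast
    with t show "t \<in> (\<Union>g\<in>Gamma0 n. E g)"
      by (auto simp: E_def)
  qed
  moreover have "uncountable {0..1::real}"
    by (simp add: uncountable_closed_interval)
  ultimately have "\<not> (\<forall>g\<in>Gamma0 n. countable (E g))"
    using countable_UN[OF countable_Gamma0] countable_subset by metis
  then obtain g where g: "g \<in> Gamma0 n" "infinite (E g)"
    using countable_finite by blast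
  have gB: "mob (realmat g) (mob B (\<i> * complex_of_real (exp t)))
      = mob (realmat g ** B) (\<i> * complex_of_real (exp t))" for t
    using B(1) by (simp add: mob_mult imaginary_axis_in_uhp)
  have "E g \<subseteq> {t. mob A (\<i> * complex_of_real (exp t)) = mob (realmat g ** B) (\<i> * complex_of_real (exp t))}"
    unfolding E_def using A(2) B(2) gB by auto
  then have "infinite {t. mob A (\<i> * complex_of_real (exp t))
      = mob (realmat g ** B) (\<i> * complex_of_real (exp t))}"
    using g(2) finite_subset by blast
  moreover have "det (realmat g ** B) = 1"
    using Gamma0_det[OF g(1)] B(1) by (simp add: det_matrix_mult_2)
  ultimately have "\<zeta> t = mob (realmat g) (\<eta> t)" if "0 \<le> t" for t
    using geodesic_eq_if_infinitely_often[OF A(1), of "realmat g ** B"] A(2) B(2) gB that by simp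
  with g(1) show thesis
    by (rule that)
qed

section \<open>The Farey complex\<close>

text \<open>In homogeneous coordinates the matrix multiplies the column (p, q). The pair (0, 0) must
  be excluded: \<open>frac_pt\<close> sends it to \<open>Infty\<close>, which \<open>g\<close> need
  not fix.\<close>

lemma bmob_frac_pt:
  assumes "det g = 1" "p \<noteq> 0 \<or> q \<noteq> 0"
  shows "bmob (realmat g) (frac_pt (p, q)) = frac_pt (g$1$1 * p + g$1$2 * q, g$2$1 * p + g$2$2 * q)"
proof (cases "q = 0")
  case True
  with assms show ?thesis
    by (auto simp: map_matrix_def bmob.simps)
next
  case False
  have lin: "real_of_int a * real_of_int p / real_of_int q + real_of_int b
      = real_of_int (a * p + b * q) / real_of_int q" for a b
    using False by (simp add: field_simps)
  show ?thesis
    using False by (simp add: map_matrix_def bmob.simps lin del: of_int_add of_int_mult)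
qed

text \<open>A common divisor of the entries of either fraction divides the determinant, hence is a
  unit. So coprimality need not be checked separately for images under a matrix.\<close>

lemma farey_neighboursI:
  assumes "\<bar>p * s - q * r\<bar> = 1"
  shows "farey_neighbours (p, q) (r, s)"
proof -
  have "is_unit c" if "c dvd p * s - q * r" for c
    using that assms by (metis dvd_abs_iff)
  then have "coprime p q" "coprime r s"
    by (auto intro!: coprimeI dvd_diff)
  with assms show ?thesis
    by simp
qed

lemma mob_in_farey:
  assumes g: "det g = 1" and z: "z \<in> farey"
  shows "mob (realmat g) z \<in> farey"
proof -
  obtain p q r s where pq: "farey_neighbours (p, q) (r, s)"
      and z: "z \<in> geodesic (frac_pt (p, q)) (frac_pt (r, s))"
    using z unfolding farey_def by auto
  let ?p = "g$1$1 * p + g$1$2 * q" and ?q = "g$2$1 * p + g$2$2 * q"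
  let ?r = "g$1$1 * r + g$1$2 * s" and ?s = "g$2$1 * r + g$2$2 * s"
  have "p \<noteq> 0 \<or> q \<noteq> 0" "r \<noteq> 0 \<or> s \<noteq> 0"
    using pq by auto
  then have "mob (realmat g) z \<in> geodesic (frac_pt (?p, ?q)) (frac_pt (?r, ?s))"
    using mob_in_geodesic[OF _ z, of "realmat g"] g by (simp add: det_realmat bmob_frac_pt del: frac_pt.simps)
  \<comment> \<open>The two fractions form the columns of a matrix, and the determinant is
    multiplicative.\<close>
  moreover have "?p * ?s - ?q * ?r = det g * (p * s - q * r)"
    by (simp add: det_2 algebra_simps)
  then have "farey_neighbours (?p, ?q) (?r, ?s)"
    using g pq by (intro farey_neighboursI) simp
  ultimately show ?thesis
    unfolding farey_def by blast
qed

lemma scaled_farey_subset_uhp: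
  assumes "0 < d"
  shows "scaled_farey d \<subseteq> uhp"
  using assms geodesic_subset_uhp
  by (fastforce simp: scaled_farey_def farey_def uhp_def)

text \<open>Conjugation by the scaling by \<open>d\<close> carries the matrix with rows \<open>(a, b)\<close>, \<open>(c, e)\<close> to the one with
  rows \<open>(a, d b)\<close>, \<open>(c / d, e)\<close>, which is integral as \<open>d\<close> divides \<open>c\<close>.\<close>

lemma mob_in_scaled_farey:
  assumes d: "d dvd n" "0 < d" and g: "g \<in> Gamma0 n" and z: "z \<in> scaled_farey d"
  shows "mob (realmat g) z \<in> scaled_farey d"
proof -
  obtain w where w: "w \<in> farey" "z = w / of_nat d"
    using z unfolding scaled_farey_def by blast
  have "int d dvd g$2$1"
    using g d unfolding Gamma0_def by (auto intro: dvd_trans[of "int d" "int n"])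
  then obtain c where c: "g$2$1 = int d * c"
    by (elim dvdE)
  define h :: "int^2^2" where
    "h = vector [vector [g$1$1, int d * g$1$2], vector [c, g$2$2]]"
  have "det h = 1"
    using g c by (simp add: Gamma0_def det_2 h_def algebra_simps)
  then have "mob (realmat h) w \<in> farey"
    using w mob_in_farey by blast
  moreover have "mob (realmat g) z = mob (realmat h) w / of_nat d"
  proof -
    \<comment> \<open>With w = d z the denominator of \<open>mob (realmat h) w\<close> becomes that
      of \<open>mob (realmat g) z\<close>, and its numerator acquires the factor d.\<close>
    have wz: "w = of_nat d * z"
      using d(2) w by simp
    have "mob (realmat h) w = (of_nat d * (complex_of_int (g$1$1) * z + complex_of_int (g$1$2))) /
        (complex_of_int (g$2$1) * z + complex_of_int (g$2$2))"
      by (simp add: mob_def map_matrix_def h_def c wz algebra_simps)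
    then show ?thesis
      using d(2) by (simp add: mob_def map_matrix_def)
  qed
  ultimately show ?thesis
    unfolding scaled_farey_def by blast
qed

section \<open>Components of the complement of the triangulation\<close>

text \<open>The constant \<open>topology\<close> yields the intended open sets only for a predicate
  satisfying \<open>istopology\<close>. Here this holds because preimages commute with intersections
  and unions.\<close>

lemma istopology_orbifold:
  "istopology (\<lambda>U. U \<subseteq> orbifold n \<and> open {z \<in> uhp. orbit n z \<in> U})"
  unfolding istopology_def
proof (intro conjI allI impI)
  fix S T
  assume "S \<subseteq> orbifold n \<and> open {z \<in> uhp. orbit n z \<in> S}" "T \<subseteq> orbifold n \<and> open {z \<in> uhp. orbit n z \<in> T}"
  moreover have "{z \<in> uhp. orbit n z \<in> S \<inter> T} = {z \<in> uhp. orbit n z \<in> S} \<inter> {z \<in> uhp. orbit n z \<in> T}"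
    by blast
  ultimately show "S \<inter> T \<subseteq> orbifold n" "open {z \<in> uhp. orbit n z \<in> S \<inter> T}"
    by (blast, simp only: open_Int)
next
  fix \<K>
  assume K: "\<forall>K\<in>\<K>. K \<subseteq> orbifold n \<and> open {z \<in> uhp. orbit n z \<in> K}"
  show "\<Union>\<K> \<subseteq> orbifold n"
    using K by blast
  have "{z \<in> uhp. orbit n z \<in> \<Union>\<K>} = (\<Union>K\<in>\<K>. {z \<in> uhp. orbit n z \<in> K})"
    by blast
  moreover have "open \<dots>"
    using K by (intro open_UN) blast
  ultimately show "open {z \<in> uhp. orbit n z \<in> \<Union>\<K>}"
    by (simp only:)
qed

lemma openin_orbifold:
  "openin (orbifold_topology n) U \<longleftrightarrow> U \<subseteq> orbifold n \<and> open {z \<in> uhp. orbit n z \<in> U}"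
  unfolding orbifold_topology_def by (simp only: topology_inverse'[OF istopology_orbifold])

lemma open_uhp: "open uhp"
  by (simp add: uhp_def open_halfspace_Im_gt)

lemma topspace_orbifold: "topspace (orbifold_topology n) = orbifold n"
proof -
  have "{z \<in> uhp. orbit n z \<in> orbifold n} = uhp"
    by (auto simp: orbifold_def)
  then have "openin (orbifold_topology n) (orbifold n)"
    by (simp add: openin_orbifold open_uhp)
  then show ?thesis
    using openin_subset openin_orbifold openin_topspace by blast
qed

lemma continuous_map_orbit:
  "continuous_map (top_of_set uhp) (orbifold_topology n) (orbit n)"
  unfolding continuous_map_def
  by (auto simp: topspace_orbifold orbifold_def openin_orbifold openin_open_eq[OF open_uhp])

text \<open>The image of \<open>C\<close> under the continuous map \<open>orbit n\<close> is
  connected and avoids \<open>Y\<close>, so it lies in a single component.\<close>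

lemma component_orbit_preimage:
  assumes C: "C \<in> components U" and U: "U = {z \<in> uhp. orbit n z \<notin> Y}"
  obtains \<Delta> where "\<Delta> \<in> connected_components_of (subtopology (orbifold_topology n) (orbifold n - Y))"
    "C \<subseteq> {z \<in> uhp. orbit n z \<in> \<Delta>}"
proof -
  let ?X = "subtopology (orbifold_topology n) (orbifold n - Y)"
  have sub: "C \<subseteq> U" "C \<subseteq> uhp" "C \<noteq> {}"
    using C U in_components_subset in_components_nonempty by blast+
  have "connectedin (top_of_set uhp) C"
    using sub in_components_connected[OF C] by (simp add: connectedin_subtopology)
  then have "connectedin (orbifold_topology n) (orbit n ` C)"
    by (rule connectedin_continuous_map_image[OF continuous_map_orbit])
  moreover have "orbit n ` C \<subseteq> orbifold n - Y"
    using sub U by (auto simp: orbifold_def)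
  ultimately have "connectedin ?X (orbit n ` C)"
    by (simp add: connectedin_subtopology)
  moreover obtain \<Delta> where "\<Delta> \<in> connected_components_of ?X" "\<not> disjnt \<Delta> (orbit n ` C)"
    using calculation connectedin_subset_topspace Union_connected_components_of[of ?X] sub(3)
    by (metis (no_types, lifting) UnionE disjnt_iff equals0I image_is_empty subsetD)
  ultimately have "\<Delta> \<in> connected_components_of ?X" "orbit n ` C \<subseteq> \<Delta>"
    using connected_components_of_maximal by blast+
  with sub that show thesis by blast
qed

text \<open>Components of \<open>U\<close> remain components in the smaller preimage of the \<Delta>
  containing their image. Conversely, a component of such a preimage extends to a component
  \<open>D\<close> of \<open>U\<close>; the image of \<open>D\<close> lies in one component, which
  meets \<Delta> and so equals it, and maximality gives equality with \<open>D\<close>.\<close>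

lemma components_orbit_preimages:
  assumes U: "U = {z \<in> uhp. orbit n z \<notin> Y}"
  shows "(\<exists>\<Delta> \<in> connected_components_of (subtopology (orbifold_topology n) (orbifold n - Y)).
            C \<in> components {z \<in> uhp. orbit n z \<in> \<Delta>}) \<longleftrightarrow> C \<in> components U"
    (is "(\<exists>\<Delta> \<in> ?\<C>. _) \<longleftrightarrow> _")
proof
  have sub: "{z \<in> uhp. orbit n z \<in> \<Delta>} \<subseteq> U" if "\<Delta> \<in> ?\<C>" for \<Delta>
    using connected_components_of_subset[OF that] U by auto
  show "\<exists>\<Delta> \<in> ?\<C>. C \<in> components {z \<in> uhp. orbit n z \<in> \<Delta>}" if C: "C \<in> components U"
  proof -
    obtain \<Delta> where \<Delta>: "\<Delta> \<in> ?\<C>" "C \<subseteq> {z \<in> uhp. orbit n z \<in> \<Delta>}"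
      using component_orbit_preimage[OF C U] by blast
    then have "C \<in> components {z \<in> uhp. orbit n z \<in> \<Delta>}"
      using components_intermediate_subset[OF C] sub by blast
    with \<Delta> show ?thesis by blast
  qed
  assume "\<exists>\<Delta> \<in> ?\<C>. C \<in> components {z \<in> uhp. orbit n z \<in> \<Delta>}"
  then obtain \<Delta> where \<Delta>: "\<Delta> \<in> ?\<C>" and C: "C \<in> components {z \<in> uhp. orbit n z \<in> \<Delta>}"
    by blast
  have C': "C \<subseteq> {z \<in> uhp. orbit n z \<in> \<Delta>}" "C \<noteq> {}" "connected C"
    using C in_components_subset in_components_nonempty in_components_connected by blast+
  then have "C \<subseteq> U" using sub[OF \<Delta>] by blast
  moreover from this C' have "U \<noteq> {}" by blast
  ultimately obtain D where D: "D \<in> components U" "C \<subseteq> D"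
    using exists_component_superset C' by metis
  obtain \<Delta>' where \<Delta>': "\<Delta>' \<in> ?\<C>" "D \<subseteq> {z \<in> uhp. orbit n z \<in> \<Delta>'}"
    using component_orbit_preimage[OF D(1) U] by blast
  have "\<Delta> \<inter> \<Delta>' \<noteq> {}"
    using C' D \<Delta>' by blast
  then have "\<Delta>' = \<Delta>"
    using \<Delta> \<Delta>' pairwise_disjoint_connected_components_of by (metis disjnt_def pairwise_def)
  then have "D = C"
    using components_maximal[OF C in_components_connected[OF D(1)]] \<Delta>' D C' by blast
  with D show "C \<in> components U" by simp
qed

text \<open>Both \<open>M\<close> and its inverse map \<open>U\<close> into itself, so
  \<open>M\<close> restricts to a homeomorphism of \<open>U\<close> and permutes its
  components.\<close>

lemma mob_image_component:
  assumes M: "det M = 1" and U: "U \<subseteq> uhp"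
    and inv: "mob M ` U \<subseteq> U" "mob (adj2 M) ` U \<subseteq> U" and C: "C \<in> components U"
  shows "mob M ` C \<in> components U"
proof -
  have sub: "C \<subseteq> U" "C \<noteq> {}"
    using C in_components_subset in_components_nonempty by blast+
  have conn: "connected (mob N ` D)" if "det N = 1" "connected D" "D \<subseteq> U" for N D
    using that U by (blast intro: connected_continuous_image continuous_on_subset[OF continuous_on_mob])
  show ?thesis
    unfolding in_components_maximal
  proof (intro conjI allI impI)
    show "mob M ` C \<noteq> {}" "mob M ` C \<subseteq> U" "connected (mob M ` C)"
      using sub inv M conn in_components_connected[OF C] by auto
    \<comment> \<open>A connected set \<open>D\<close> around the image is pulled back by the
      inverse, where maximality of \<open>C\<close> confines it.\<close>
    fix D assume D: "D \<noteq> {} \<and> mob M ` C \<subseteq> D \<and> D \<subseteq> U \<and> connected D"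
    have "C \<subseteq> mob (adj2 M) ` D"
    proof
      fix z assume z: "z \<in> C"
      then have "z = mob (adj2 M) (mob M z)"
        using sub U M by (metis mob_adj2 subsetD)
      then show "z \<in> mob (adj2 M) ` D"
        using z D by blast
    qed
    moreover have "mob (adj2 M) ` D \<subseteq> mob (adj2 M) ` U"
      using D by (intro image_mono) blast
    then have "mob (adj2 M) ` D \<subseteq> U"
      using inv(2) by (rule order_trans)
    moreover have "connected (mob (adj2 M) ` D)"
      using D M by (intro conn) simp_all
    ultimately have "mob (adj2 M) ` D \<subseteq> C"
      using components_maximal[OF C, of "mob (adj2 M) ` D"] sub(2) by blast
    have "D \<subseteq> mob M ` C"
    proof
      fix z assume z: "z \<in> D"
      then have "z \<in> uhp"
        using D U by blast
      then have "z = mob M (mob (adj2 M) z)"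
        by (simp only: mob_adj2'[OF M])
      with z \<open>mob (adj2 M) ` D \<subseteq> C\<close> show "z \<in> mob M ` C"
        by blast
    qed
    with D show "D = mob M ` C" by blast
  qed
qed

section \<open>Cutting sequences\<close>

text \<open>Crossing times increase from 0, so only \<open>s \<ge> 0\<close> occurs. This matters
  since lifts are compared only at nonnegative times.\<close>

lemma cutting_words_cong:
  assumes "\<And>s u l. 0 \<le> s \<Longrightarrow> c s u l \<longleftrightarrow> c' s u l"
  shows "cutting_words c = cutting_words c'"
proof -
  have "c (real_of_ereal (\<tau> k)) (\<tau> (Suc k)) l \<longleftrightarrow> c' (real_of_ereal (\<tau> k)) (\<tau> (Suc k)) l"
    if "\<tau> 0 = 0" "incseq \<tau>" for \<tau> k l
    using assms that incseqD[of \<tau> 0 k] by (simp add: real_of_ereal_pos)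
  then show ?thesis
    unfolding cutting_words_def by (auto split: option.splits cong: conj_cong)
qed

text \<open>Determinant 1 preserves the clockwise order of the vertices, so entry and exit sides
  correspond and the letter is unchanged.\<close>

lemma cuts_triangle_mob:
  assumes M: "det M = 1" and \<zeta>: "geodesic_ray \<zeta>"
    and \<eta>: "\<And>t. 0 \<le> t \<Longrightarrow> \<eta> t = mob M (\<zeta> t)"
    and s: "0 \<le> s" and cut: "cuts_triangle \<zeta> A B C s u l"
  shows "cuts_triangle \<eta> (bmob M A) (bmob M B) (bmob M C) s u l"
proof -
  \<comment> \<open>Needed to apply the hypothesis on \<eta> at the exit time. For
    \<open>u = \<infinity>\<close> the value is 0 by convention.\<close>
  have "0 \<le> real_of_ereal u"
    using cut s unfolding cuts_triangle_def by (cases u) auto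
  then show ?thesis
    using cut s M unfolding cuts_triangle_def
    by (auto simp: \<eta> clockwise_bmob mob_in_geodesic mob_in_ideal_triangle
        intro: ends_at_mob[OF M \<zeta> _ \<eta>] split: letter.splits if_splits)
qed

section \<open>The quotient triangulation as a subset of the orbifold\<close>

lemma side_pairing_subset_uhp: "(s, g) \<in> side_pairings S \<Longrightarrow> s \<subseteq> uhp"
  by (erule side_pairings.cases) (use geodesic_subset_uhp ideal_segment_subset_uhp in blast)+

text \<open>Each elementary identification applies an element of \<open>Gamma0 n\<close> to a point
  of \<open>uhp\<close>, so the orbit is constant along a chain of identifications in either
  direction.\<close>

lemma side_equiv_orbit:
  assumes fd: "fundamental_domain n S P" and zw: "(z, w) \<in> side_equiv S P"
  shows "orbit n z = orbit n w"
proof -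
  define r where "r = {(z, mob (realmat g) z) | s g z. (s, g) \<in> side_pairings S \<and> z \<in> s}"
  have r: "orbit n x = orbit n y" if xy: "(x, y) \<in> r" for x y
  proof -
    obtain s g where sg: "(s, g) \<in> side_pairings S" "x \<in> s" "y = mob (realmat g) x"
      using xy unfolding r_def by blast
    then have "g \<in> Gamma0 n" "x \<in> uhp"
      using fd side_pairing_subset_uhp[OF sg(1)] unfolding fundamental_domain_def by blast+
    then show ?thesis
      by (simp only: sg(3) orbit_mob)
  qed
  have "(z, w) \<in> (r \<union> r\<inverse>)\<^sup>*"
    using zw unfolding side_equiv_def r_def Let_def by blast
  then show ?thesis
  proof induction
    case (step x y)
    then show ?case
      using r[of x y] r[of y x] by auto
  qed simp
qed

text \<open>The polygon disappears here: every orbit meets \<open>P\<close>, and by invariance the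
  representative in \<open>P\<close> of a point of \<open>scaled_farey d\<close> is again in
  \<open>scaled_farey d\<close>.\<close>

lemma to_orbifold_quotient_triangulation:
  assumes fd: "fundamental_domain n S P" and d: "d dvd n" "0 < d"
  shows "to_orbifold n ` quotient_triangulation d S P = orbit n ` scaled_farey d"
proof -
  \<comment> \<open>The class contains \<open>z\<close> itself and otherwise only points of the same
    orbit, so the union of orbits is a single one.\<close>
  have class_orbit: "to_orbifold n (side_equiv S P `` {z}) = orbit n z" if "z \<in> P" for z
  proof -
    have "z \<in> side_equiv S P `` {z}"
      using that by (simp add: side_equiv_def Let_def)
    then show ?thesis
      using side_equiv_orbit[OF fd] unfolding to_orbifold_def by blast
  qed
  have "to_orbifold n ` quotient_triangulation d S P = orbit n ` (P \<inter> scaled_farey d)"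
    unfolding quotient_triangulation_def quotient_def by (auto simp: class_orbit image_iff)
  also have "\<dots> = orbit n ` scaled_farey d"
  proof
    show "orbit n ` scaled_farey d \<subseteq> orbit n ` (P \<inter> scaled_farey d)"
    proof
      fix y assume "y \<in> orbit n ` scaled_farey d"
      then obtain z where z: "z \<in> scaled_farey d" "y = orbit n z"
        by blast
      then have "z \<in> uhp"
        using scaled_farey_subset_uhp[OF d(2)] by blast
      with fd obtain g where "g \<in> Gamma0 n" "mob (realmat g) z \<in> P"
        unfolding fundamental_domain_def by blast
      with z \<open>z \<in> uhp\<close> show "y \<in> orbit n ` (P \<inter> scaled_farey d)"
        using mob_in_scaled_farey[OF d] orbit_mob by (metis IntI imageI)
    qed
  qed blast
  finally show ?thesis .
qed

text \<open>Invariance makes \<open>scaled_farey d\<close> a union of orbits, so it is the full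
  preimage in \<open>uhp\<close> of its image.\<close>

lemma orbit_in_scaled_farey_iff:
  assumes d: "d dvd n" "0 < d" and z: "z \<in> uhp"
  shows "orbit n z \<in> orbit n ` scaled_farey d \<longleftrightarrow> z \<in> scaled_farey d"
proof
  assume "orbit n z \<in> orbit n ` scaled_farey d"
  then obtain w where "w \<in> scaled_farey d" "orbit n w = orbit n z"
    by force
  then show "z \<in> scaled_farey d"
    by (metis orbit_eqD mob_in_scaled_farey[OF d])
qed blast

theorem theorem3p2:
  fixes n :: nat and S :: farey_symbol and P :: "complex set"
    and \<zeta>' :: "real \<Rightarrow> complex" and \<alpha> :: real
  assumes "n \<ge> 1"
    and "is_Pn n S P"
    and "geodesic_ray \<zeta>'"
    and "\<zeta>' 0 \<in> geodesic (Pt 0) Infty"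
    and "ends_at \<zeta>' (Pt \<alpha>)"
    and "\<alpha> > 0"
  shows "\<exists>\<zeta> :: real \<Rightarrow> complex set. (\<forall>t. \<zeta> t = orbit n (\<zeta>' t)) \<and>
           (\<forall>d. d dvd n \<longrightarrow>
              cutting_sequences \<zeta>' (scaled_farey d) =
              orbifold_cutting_sequences n \<zeta> (to_orbifold n ` quotient_triangulation d S P))"
proof (intro exI conjI allI impI)
  define \<zeta> where "\<zeta> = (\<lambda>t. orbit n (\<zeta>' t))"
  show "\<zeta> t = orbit n (\<zeta>' t)" for t
    by (simp add: \<zeta>_def)
  fix d assume "d dvd n"
  \<comment> \<open>Zero divides only zero, so \<open>n \<ge> 1\<close> excludes
    \<open>d = 0\<close>, for which \<open>z / of_nat d\<close> would be constantly 0.\<close>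
  with assms(1) have d: "d dvd n" "0 < d"
    by (auto intro: Nat.gr0I)
  have fd: "fundamental_domain n S P"
    using assms(2) by (simp add: is_Pn_def)
  let ?U = "uhp - scaled_farey d"
  have U: "?U = {z \<in> uhp. orbit n z \<notin> orbit n ` scaled_farey d}"
    using orbit_in_scaled_farey_iff[OF d] by blast
  have inv: "mob (realmat g) ` ?U \<subseteq> ?U" if g: "g \<in> Gamma0 n" for g
  proof -
    have "z \<in> scaled_farey d" if "z \<in> uhp" "mob (realmat g) z \<in> scaled_farey d" for z
      using mob_in_scaled_farey[OF d Gamma0_adj2[OF g] that(2)] that(1) g
      by (simp add: realmat_adj2 mob_adj2 Gamma0_det)
    then show ?thesis
      using mob_in_uhp[OF Gamma0_det[OF g]] by blast
  qed
  have lift: "lift_of n \<zeta> \<zeta>'"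
    using assms(3) by (simp add: lift_of_def \<zeta>_def)
  \<comment> \<open>The orbifold side allows a different lift for every letter. The ray \<zeta>' is
    one lift; any other is moved onto it by a group element together with the triangle it
    cuts.\<close>
  have "(\<exists>A B C. ideal_triangle A B C \<in> components ?U \<and> cuts_triangle \<zeta>' A B C s u l) \<longleftrightarrow>
      (\<exists>\<eta> A B C. lift_of n \<zeta> \<eta> \<and> ideal_triangle A B C \<in> components ?U \<and> cuts_triangle \<eta> A B C s u l)"
    (is "?lhs \<longleftrightarrow> ?rhs") if s: "0 \<le> s" for s u l
  proof
    show "?lhs \<Longrightarrow> ?rhs"
      using lift by blast
    assume ?rhs
    then obtain \<eta> A B C where \<eta>: "lift_of n \<zeta> \<eta>"
      and comp: "ideal_triangle A B C \<in> components ?U" and cut: "cuts_triangle \<eta> A B C s u l"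
      by blast
    from \<eta> have ray: "geodesic_ray \<eta>" and "\<And>t. 0 \<le> t \<Longrightarrow> orbit n (\<eta> t) = orbit n (\<zeta>' t)"
      by (simp_all add: lift_of_def \<zeta>_def)
    then obtain g where g: "g \<in> Gamma0 n" "\<And>t. 0 \<le> t \<Longrightarrow> \<zeta>' t = mob (realmat g) (\<eta> t)"
      using lifts_differ_by_Gamma0[OF assms(3)] by blast
    let ?b = "bmob (realmat g)"
    have "cuts_triangle \<zeta>' (?b A) (?b B) (?b C) s u l"
      using cuts_triangle_mob[OF Gamma0_det[OF g(1)] ray g(2) s cut] .
    \<comment> \<open>The moved triangle is still one of the triangulation, since \<open>g\<close>
      permutes the components of \<open>?U\<close>.\<close>
    moreover have "ideal_triangle (?b A) (?b B) (?b C) \<in> components ?U"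
      using mob_image_component[OF Gamma0_det[OF g(1)] _ inv[OF g(1)] _ comp]
        inv[OF Gamma0_adj2[OF g(1)]] mob_image_ideal_triangle[OF Gamma0_det[OF g(1)]]
      by (simp add: realmat_adj2)
    ultimately show ?lhs
      by blast
  qed
  \<comment> \<open>Components of the preimages of the \<Delta> are replaced by components of
    \<open>?U\<close>, which leaves the equivalence just shown, letter by letter.\<close>
  then show "cutting_sequences \<zeta>' (scaled_farey d) =
      orbifold_cutting_sequences n \<zeta> (to_orbifold n ` quotient_triangulation d S P)"
    unfolding cutting_sequences_def orbifold_cutting_sequences_def
      to_orbifold_quotient_triangulation[OF fd d]
    by (intro cutting_words_cong) (use components_orbit_preimages[OF U] in blast)
qed

end
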